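(* Let $M$ be an ordered $\Gamma$-semigroup. Then $M$ is left regular if and only if every left ideal of $M$ is semiprime; and $M$ is right regular if and only if every right ideal of $M$ is semiprime.
   Context: A $\Gamma$-semigroup consists of nonempty sets $M$ and $\Gamma$ and a well-defined operation $M\times\Gamma\times M\to M$, $(a,\gamma,b)\mapsto a\gamma b$, with $a\gamma(b\mu c)=(a\gamma b)\mu c$ for all $a,b,c\in M$, $\gamma,\mu\in\Gamma$. An ordered $\Gamma$-semigroup ($po$-$\Gamma$-semigroup) is a $\Gamma$-semigroup $M$ with a partial order $\le$ on $M$ such that $a\le b$ implies $a\gamma c\le b\gamma c$ and $c\gamma a\le c\gamma b$ for all $c\in M$, $\gamma\in\Gamma$. Notation: for $A,B\subseteq M$, $A\Gamma B=\{a\gamma b\mid a\in A,\ b\in B,\ \gamma\in\Gamma\}$. For fixed $x\in M$, $\gamma\in\Gamma$, $M\Gamma x\gamma x=\{u\mu (x\gamma x)\mid u\in M,\ \mu\in\Gamma\}$ and $x\gamma x\Gamma M=\{(x\gamma x)\mu u\mid u\in M,\ \mu\in\Gamma\}$. For $H\subseteq M$, $(H]=\{t\in M\mid t\le h\text{ for some }h\in H\}$. $M$ is left regular (resp. right regular) if $x\in (M\Gamma x\gamma x]$ (resp. $x\in (x\gamma x\Gamma M]$) for every $x\in M$ and every $\gamma\in\Gamma$. A left (resp. right) ideal of $M$ is a nonempty subset $A\subseteq M$ such that (1) $M\Gamma A\subseteq A$ (resp. $A\Gamma M\subseteq A$) and (2) if $a\in A$ and $b\in M$ with $b\le a$, then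 $b\in A$. A subset $T\subseteq M$ is semiprime if for every $x\in M$ and every $\gamma\in\Gamma$ with $x\gamma x\in T$ we have $x\in T$. *)

theory Defs
  imports Main
begin

text \<open>The order is a relation \<open>r \<subseteq> M \<times> M\<close>, where \<open>(a, b) \<in> r\<close> stands for \<open>a \<le> b\<close>.\<close>

locale gamma_semigroup =
  fixes M :: "'a set" and \<Gamma> :: "'g set" and opn :: "'a \<Rightarrow> 'g \<Rightarrow> 'a \<Rightarrow> 'a"
  assumes M_nonempty: "M \<noteq> {}"
    and Gamma_nonempty: "\<Gamma> \<noteq> {}"
    and opn_closed: "\<lbrakk>a \<in> M; \<gamma> \<in> \<Gamma>; b \<in> M\<rbrakk> \<Longrightarrow> opn a \<gamma> b \<in> M"
    and opn_assoc: "\<lbrakk>a \<in> M; b \<in> M; c \<in> M; \<gamma> \<in> \<Gamma>; \<mu> \<in> \<Gamma>\<rbrakk>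
      \<Longrightarrow> opn a \<gamma> (opn b \<mu> c) = opn (opn a \<gamma> b) \<mu> c"

locale po_gamma_semigroup = gamma_semigroup M \<Gamma> opn
  for M :: "'a set" and \<Gamma> :: "'g set" and opn :: "'a \<Rightarrow> 'g \<Rightarrow> 'a \<Rightarrow> 'a" +
  fixes r :: "'a rel"
  assumes order: "partial_order_on M r"
    and opn_mono_left: "\<lbrakk>(a, b) \<in> r; c \<in> M; \<gamma> \<in> \<Gamma>\<rbrakk> \<Longrightarrow> (opn a \<gamma> c, opn b \<gamma> c) \<in> r"
    and opn_mono_right: "\<lbrakk>(a, b) \<in> r; c \<in> M; \<gamma> \<in> \<Gamma>\<rbrakk> \<Longrightarrow> (opn c \<gamma> a, opn c \<gamma> b) \<in> r"

definition gamma_prod :: "'g set \<Rightarrow> ('a \<Rightarrow> 'g \<Rightarrow> 'a \<Rightarrow> 'a) \<Rightarrow> 'a set \<Rightarrow> 'a set \<Rightarrow> 'a set" where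
  "gamma_prod \<Gamma> opn A B = {opn a \<gamma> b | a \<gamma> b. a \<in> A \<and> \<gamma> \<in> \<Gamma> \<and> b \<in> B}"

definition down_closure :: "'a set \<Rightarrow> 'a rel \<Rightarrow> 'a set \<Rightarrow> 'a set" where
  "down_closure M r H = {t \<in> M. \<exists>h\<in>H. (t, h) \<in> r}"

definition left_regular :: "'a set \<Rightarrow> 'g set \<Rightarrow> ('a \<Rightarrow> 'g \<Rightarrow> 'a \<Rightarrow> 'a) \<Rightarrow> 'a rel \<Rightarrow> bool" where
  "left_regular M \<Gamma> opn r \<longleftrightarrow>
    (\<forall>x\<in>M. \<forall>\<gamma>\<in>\<Gamma>. x \<in> down_closure M r (gamma_prod \<Gamma> opn M {opn x \<gamma> x}))"

definition right_regular :: "'a set \<Rightarrow> 'g set \<Rightarrow> ('a \<Rightarrow> 'g \<Rightarrow> 'a \<Rightarrow> 'a) \<Rightarrow> 'a rel \<Rightarrow> bool" where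
  "right_regular M \<Gamma> opn r \<longleftrightarrow>
    (\<forall>x\<in>M. \<forall>\<gamma>\<in>\<Gamma>. x \<in> down_closure M r (gamma_prod \<Gamma> opn {opn x \<gamma> x} M))"

definition left_ideal ::
  "'a set \<Rightarrow> 'g set \<Rightarrow> ('a \<Rightarrow> 'g \<Rightarrow> 'a \<Rightarrow> 'a) \<Rightarrow> 'a rel \<Rightarrow> 'a set \<Rightarrow> bool" where
  "left_ideal M \<Gamma> opn r A \<longleftrightarrow>
    A \<noteq> {} \<and> A \<subseteq> M \<and> gamma_prod \<Gamma> opn M A \<subseteq> A \<and>
    (\<forall>a\<in>A. \<forall>b\<in>M. (b, a) \<in> r \<longrightarrow> b \<in> A)"

definition right_ideal ::
  "'a set \<Rightarrow> 'g set \<Rightarrow> ('a \<Rightarrow> 'g \<Rightarrow> 'a \<Rightarrow> 'a) \<Rightarrow> 'a rel \<Rightarrow> 'a set \<Rightarrow> bool" where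
  "right_ideal M \<Gamma> opn r A \<longleftrightarrow>
    A \<noteq> {} \<and> A \<subseteq> M \<and> gamma_prod \<Gamma> opn A M \<subseteq> A \<and>
    (\<forall>a\<in>A. \<forall>b\<in>M. (b, a) \<in> r \<longrightarrow> b \<in> A)"

definition semiprime ::
  "'a set \<Rightarrow> 'g set \<Rightarrow> ('a \<Rightarrow> 'g \<Rightarrow> 'a \<Rightarrow> 'a) \<Rightarrow> 'a set \<Rightarrow> bool" where
  "semiprime M \<Gamma> opn T \<longleftrightarrow>
    T \<subseteq> M \<and> (\<forall>x\<in>M. \<forall>\<gamma>\<in>\<Gamma>. opn x \<gamma> x \<in> T \<longrightarrow> x \<in> T)"

end

theory Submission
  imports Defs
begin

text \<open>If left ideals are semiprime, apply this to \<open>L = (M\<Gamma>(x\<gamma>x)]\<close>: it contains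
  \<open>(x\<gamma>x)\<gamma>(x\<gamma>x)\<close>, hence \<open>x\<gamma>x\<close>, hence \<open>x\<close>. The statement for right ideals is the one for left
  ideals in the opposite \<open>\<Gamma>\<close>-semigroup.\<close>

lemma semiprimeD:
  assumes "semiprime M \<Gamma> opn T" "x \<in> M" "\<gamma> \<in> \<Gamma>" "opn x \<gamma> x \<in> T"
  shows "x \<in> T"
proof -
  have "\<forall>x\<in>M. \<forall>\<gamma>\<in>\<Gamma>. opn x \<gamma> x \<in> T \<longrightarrow> x \<in> T"
    using assms(1) unfolding semiprime_def ..
  from this[rule_format, OF assms(2-4)] show ?thesis .
qed

context po_gamma_semigroup
begin

lemma order_refl: "a \<in> M \<Longrightarrow> (a, a) \<in> r"
  using order by (auto simp: partial_order_on_def preorder_on_def refl_on_def)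

lemma order_trans: "\<lbrakk>(a, b) \<in> r; (b, c) \<in> r\<rbrakk> \<Longrightarrow> (a, c) \<in> r"
  using order unfolding partial_order_on_def preorder_on_def trans_def by blast

lemma opn_in_down_closure:
  assumes "u \<in> M" "\<mu> \<in> \<Gamma>" "y \<in> M"
  shows "opn u \<mu> y \<in> down_closure M r (gamma_prod \<Gamma> opn M {y})"
  using assms opn_closed[OF assms] order_refl[OF opn_closed[OF assms]]
  unfolding down_closure_def gamma_prod_def by blast

text \<open>Associativity turns a left multiple of \<open>opn u \<nu> y\<close> into
  \<open>opn (opn b \<mu> u) \<nu> y\<close>, which is again a multiple of \<open>y\<close>;
  monotonicity carries this over to everything below such a multiple. It is needed for
  \<open>y = opn x \<gamma> x\<close>.\<close>

lemma left_ideal_down_closure: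
  assumes y: "y \<in> M"
  shows "left_ideal M \<Gamma> opn r (down_closure M r (gamma_prod \<Gamma> opn M {y}))"
    (is "left_ideal M \<Gamma> opn r ?L")
proof -
  \<comment> \<open>Any \<gamma> will do: it only supplies a witness that \<open>?L\<close> is
    nonempty.\<close>
  obtain \<gamma> where \<gamma>: "\<gamma> \<in> \<Gamma>"
    using Gamma_nonempty by blast
  then have "opn y \<gamma> y \<in> ?L"
    using y by (intro opn_in_down_closure)
  moreover have "opn b \<mu> a \<in> ?L" if b: "b \<in> M" and \<mu>: "\<mu> \<in> \<Gamma>" and a: "a \<in> ?L" for a b \<mu>
  proof -
    obtain u \<nu> where u: "u \<in> M" and \<nu>: "\<nu> \<in> \<Gamma>" and le: "(a, opn u \<nu> y) \<in> r" and "a \<in> M"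
      using a by (auto simp: down_closure_def gamma_prod_def)
    have "(opn b \<mu> a, opn (opn b \<mu> u) \<nu> y) \<in> r"
      using opn_mono_right[OF le b \<mu>] opn_assoc[OF b u y \<mu> \<nu>] by simp
    moreover have "opn b \<mu> u \<in> M" "opn b \<mu> a \<in> M"
      using b \<mu> u \<open>a \<in> M\<close> by (auto intro: opn_closed)
    ultimately show ?thesis
      using \<nu> unfolding down_closure_def gamma_prod_def by blast
  qed
  then have "gamma_prod \<Gamma> opn M ?L \<subseteq> ?L"
    \<comment> \<open>\<open>?L\<close> itself contains a \<open>gamma_prod\<close>; the
      instantiation unfolds the outer product only.\<close>
    unfolding gamma_prod_def[of \<Gamma> opn M ?L] by blast
  moreover have "b \<in> ?L" if "a \<in> ?L" "b \<in> M" "(b, a) \<in> r" for a b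
    using that order_trans unfolding down_closure_def by blast
  moreover have "?L \<subseteq> M"
    by (auto simp: down_closure_def)
  ultimately show ?thesis
    unfolding left_ideal_def by blast
qed

theorem left_regular_iff_semiprime:
  "left_regular M \<Gamma> opn r \<longleftrightarrow> (\<forall>A. left_ideal M \<Gamma> opn r A \<longrightarrow> semiprime M \<Gamma> opn A)"
proof (intro iffI allI impI)
  fix A
  assume reg: "left_regular M \<Gamma> opn r" and A: "left_ideal M \<Gamma> opn r A"
  have "x \<in> A" if x: "x \<in> M" and \<gamma>: "\<gamma> \<in> \<Gamma>" and xx: "opn x \<gamma> x \<in> A" for x \<gamma>
  proof -
    \<comment> \<open>Regularity bounds \<open>x\<close> by a left multiple of its square. That
      multiple lies in \<open>A\<close> by absorption, and \<open>x\<close> follows by downward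
      closure.\<close>
    obtain u \<mu> where "u \<in> M" "\<mu> \<in> \<Gamma>" and le: "(x, opn u \<mu> (opn x \<gamma> x)) \<in> r"
      using reg[unfolded left_regular_def, rule_format, OF x \<gamma>]
      by (auto simp: down_closure_def gamma_prod_def)
    then have "opn u \<mu> (opn x \<gamma> x) \<in> A"
      using A xx unfolding left_ideal_def gamma_prod_def by blast
    then show ?thesis
      using A x le unfolding left_ideal_def by blast
  qed
  moreover have "A \<subseteq> M"
    using A by (simp add: left_ideal_def)
  ultimately show "semiprime M \<Gamma> opn A"
    unfolding semiprime_def by (intro conjI ballI impI)
next
  assume semi: "\<forall>A. left_ideal M \<Gamma> opn r A \<longrightarrow> semiprime M \<Gamma> opn A"
  show "left_regular M \<Gamma> opn r"
    unfolding left_regular_def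
  proof (intro ballI)
    fix x \<gamma>
    assume x: "x \<in> M" and \<gamma>: "\<gamma> \<in> \<Gamma>"
    let ?y = "opn x \<gamma> x"
    let ?L = "down_closure M r (gamma_prod \<Gamma> opn M {?y})"
    have y: "?y \<in> M"
      by (rule opn_closed[OF x \<gamma> x])
    then have L: "semiprime M \<Gamma> opn ?L"
      by (intro semi[rule_format] left_ideal_down_closure)
    \<comment> \<open>Without an identity, \<open>?y\<close> need not be a left multiple of itself,
      but its square is one. Hence semiprimeness is used twice, to descend first to
      \<open>?y\<close> and then to \<open>x\<close>.\<close>
    have "opn ?y \<gamma> ?y \<in> ?L"
      by (rule opn_in_down_closure[OF y \<gamma> y])
    then show "x \<in> ?L"
      by (intro semiprimeD[OF L x \<gamma>] semiprimeD[OF L y \<gamma>])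
  qed
qed

text \<open>Swapping the arguments reads associativity from right to left and exchanges the two
  monotonicity laws, so the axioms as a whole are self-dual.\<close>

lemma opposite: "po_gamma_semigroup M \<Gamma> (\<lambda>a \<gamma> b. opn b \<gamma> a) r"
  by unfold_locales
    (simp_all add: M_nonempty Gamma_nonempty opn_closed opn_assoc order
      opn_mono_left opn_mono_right)

end

lemma gamma_prod_opposite:
  "gamma_prod \<Gamma> (\<lambda>a \<gamma> b. opn b \<gamma> a) A B = gamma_prod \<Gamma> opn B A"
  by (auto simp: gamma_prod_def)

lemma left_regular_opposite:
  "left_regular M \<Gamma> (\<lambda>a \<gamma> b. opn b \<gamma> a) r \<longleftrightarrow> right_regular M \<Gamma> opn r"
  \<comment> \<open>With \<open>opn\<close> left schematic, the left-hand side would match every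
    operation and the rewriting would loop; hence the instantiation.\<close>
  by (simp add: left_regular_def right_regular_def gamma_prod_opposite[of \<Gamma> opn])

lemma left_ideal_opposite:
  "left_ideal M \<Gamma> (\<lambda>a \<gamma> b. opn b \<gamma> a) r A \<longleftrightarrow> right_ideal M \<Gamma> opn r A"
  by (simp add: left_ideal_def right_ideal_def gamma_prod_opposite[of \<Gamma> opn])

text \<open>Only squares \<open>opn x \<gamma> x\<close> occur, and these are unchanged when the
  factors are swapped.\<close>

lemma semiprime_opposite:
  "semiprime M \<Gamma> (\<lambda>a \<gamma> b. opn b \<gamma> a) A \<longleftrightarrow> semiprime M \<Gamma> opn A"
  by (simp add: semiprime_def)

theorem theorem8:
  fixes M :: "'a set" and \<Gamma> :: "'g set"
    and opn :: "'a \<Rightarrow> 'g \<Rightarrow> 'a \<Rightarrow> 'a" and r :: "'a rel"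
  assumes "po_gamma_semigroup M \<Gamma> opn r"
  shows "(left_regular M \<Gamma> opn r \<longleftrightarrow>
           (\<forall>A. left_ideal M \<Gamma> opn r A \<longrightarrow> semiprime M \<Gamma> opn A)) \<and>
         (right_regular M \<Gamma> opn r \<longleftrightarrow>
           (\<forall>A. right_ideal M \<Gamma> opn r A \<longrightarrow> semiprime M \<Gamma> opn A))"
  using po_gamma_semigroup.left_regular_iff_semiprime[OF assms]
    po_gamma_semigroup.left_regular_iff_semiprime[OF po_gamma_semigroup.opposite[OF assms]]
  \<comment> \<open>Fixing \<open>opn\<close> confines the translation to the second fact, the one
    about the opposite operation; the first stays as it is.\<close>
  unfolding left_regular_opposite[of M \<Gamma> opn] left_ideal_opposite[of M \<Gamma> opn]
    semiprime_opposite[of M \<Gamma> opn]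
  by (rule conjI)

end
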